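(* Consider the schemata $(\mathrm{A_{M8}})$: $(\epsilon ab\wedge\epsilon cd)\supset(\epsilon aa\wedge\epsilon cc\wedge(\epsilon bc\supset(\epsilon ad\wedge\epsilon ba)))$; $(\mathrm{A_{S1}})$: $(\epsilon ab\wedge\epsilon cd)\supset(\epsilon aa\wedge(\epsilon bc\supset(\epsilon ad\wedge\epsilon ba)))$; $(\mathrm{A_{S2}})$: $(\epsilon ab\wedge\epsilon cd)\supset(\epsilon cc\wedge(\epsilon bc\supset(\epsilon ad\wedge\epsilon ba)))$; $(\mathrm{A_{S3N}})$: $\epsilon ab\supset(\epsilon aa\wedge(\epsilon bc\supset(\epsilon bb\wedge(\epsilon cd\supset(\epsilon ad\wedge\epsilon ba)))))$; $(\mathrm{A_{S3Nd}})$: $\epsilon ab\supset(\epsilon aa\wedge((\epsilon bc\wedge\epsilon cd)\supset(\epsilon ad\wedge\epsilon ba)))$. These five schemata, each characteristic of $\mathbf{L_1}$, are nontrivial with respect to $(\mathrm{A_t})$, and moreover for every ordered pair $(X,Y)$ of distinct schemata among these five, $X$ is quasi-nontrivial with respect to $Y$; that is: $(\mathrm{A_{M8}})$ is quasi-nontrivial w.r.t. each of $(\mathrm{A_{S1}}),(\mathrm{A_{S2}}),(\mathrm{A_{S3N}}),(\mathrm{A_{S3Nd}})$; $(\mathrm{A_{S1}})$ w.r.t. each of $(\mathrm{A_{M8}}),(\mathrm{A_{S2}}),(\mathrm{A_{S3N}}),(\mathrm{A_{S3Nd}})$; $(\mathrm{A_{S2}})$ w.r.t. each of $(\mathrm{A_{M8}}),(\mathrm{A_{S1}}),(\mathrm{A_{S3N}}),(\mathrm{A_{S3Nd}})$;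 $(\mathrm{A_{S3N}})$ w.r.t. each of $(\mathrm{A_{M8}}),(\mathrm{A_{S1}}),(\mathrm{A_{S2}}),(\mathrm{A_{S3Nd}})$; $(\mathrm{A_{S3Nd}})$ w.r.t. each of $(\mathrm{A_{M8}}),(\mathrm{A_{S1}}),(\mathrm{A_{S2}}),(\mathrm{A_{S3N}})$.
   Context: $\mathbf{L_1}$: formulas built from atomic $\epsilon xy$ ($x,y$ name variables) by $\neg,\vee$ (other connectives defined); $\mathbf{L_1}$ is the closure under modus ponens of all instances of classical tautologies and all instances of (Ax1) $\epsilon ab\supset\epsilon aa$, (Ax2) $(\epsilon ab\wedge\epsilon bc)\supset\epsilon ac$, (Ax3) $(\epsilon ab\wedge\epsilon bc)\supset\epsilon ba$. A schema is characteristic of $\mathbf{L_1}$ if the closure under modus ponens of all tautology instances and all its instances (substituting name variables for name variables) equals $\mathbf{L_1}$. A formula is an instance of a tautology if it is a tautology when distinct atomic formulas are treated as distinct propositional atoms. $nv(A)$: the tuple of distinct name variables of $A$ ordered by first occurrence from the left. $(\mathrm{A_t})$: $\epsilon ab\supset(\epsilon aa\wedge(\epsilon bc\supset(\epsilon ac\wedge\epsilon ba)))$. Trivial w.r.t. $(\mathrm{A_t})$: $A$ with $nv(A)=(x_1,\dots,x_n)$, $n\ge3$, is trivial if for some permutation $\rho$ of $\{1,\dots,n\}$ and distinct name variables $y_1,\dots,y_{n-3}$ not among the $x_i$ nor $a,b,c$, the substitution sending $x_{\rho(1)},x_{\rho(2)},x_{\rho(3)}$ to $a,b,c$ and $x_{\rho(3+j)}$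 to $y_j$ turns $A$ into $\sigma(A)$ with $\sigma(A)\equiv(\mathrm{A_t})$ a tautology instance; nontrivial = not trivial. Quasi-trivial: for schemata $A,B$ with $nv(A)=(x_1,\dots,x_n)$, $nv(B)=(y_1,\dots,y_m)$, $n,m\ge3$, $A$ is quasi-trivial w.r.t. $B$ if (when $n\le m$) for some permutation $\rho$ of $\{1,\dots,m\}$ and distinct name variables $u_1,\dots,u_{m-n}$ not among the $x_i,y_j$, the substitution $\sigma$ simultaneously sending $y_{\rho(i)}$ to $x_i$ ($i\le n$) and $y_{\rho(n+j)}$ to $u_j$ makes $\sigma(B)\equiv A$ a tautology instance; or (when $n>m$) for some permutation $\rho$ of $\{1,\dots,n\}$ and distinct name variables $v_1,\dots,v_{n-m}$ not among the $x_i,y_j$, the substitution $\sigma$ sending $x_{\rho(i)}$ to $y_i$ ($i\le m$) and $x_{\rho(m+j)}$ to $v_j$ makes $\sigma(A)\equiv B$ a tautology instance. Quasi-nontrivial = not quasi-trivial. (All five schemata above have $nv=(a,b,c,d)$.) *)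

theory Defs
  imports Main "HOL-Combinatorics.Permutations" "HOL-Combinatorics.List_Permutation"
begin

section \<open>Formulas\<close>

text \<open>Name variables form a countably infinite supply; the four that occur in the
  schemata are fixed, pairwise distinct, members of it.\<close>

type_synonym name = nat

abbreviation va :: name where "va \<equiv> 0"
abbreviation vb :: name where "vb \<equiv> 1"
abbreviation vc :: name where "vc \<equiv> 2"
abbreviation vd :: name where "vd \<equiv> 3"

datatype fm =
    Eps name name  (\<open>\<epsilon>\<close>)
  | Neg fm         (\<open>\<sim>_\<close> [75] 75)
  | Dis fm fm      (infixl \<open>\<^bold>\<or>\<close> 65)

definition Con :: "fm \<Rightarrow> fm \<Rightarrow> fm"  (infixl \<open>\<^bold>\<and>\<close> 70) where
  "A \<^bold>\<and> B = \<sim>(\<sim>A \<^bold>\<or> \<sim>B)"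

definition Imp :: "fm \<Rightarrow> fm \<Rightarrow> fm"  (infixr \<open>\<^bold>\<supset>\<close> 60) where
  "A \<^bold>\<supset> B = \<sim>A \<^bold>\<or> B"

definition Equ :: "fm \<Rightarrow> fm \<Rightarrow> fm"  (infix \<open>\<^bold>\<equiv>\<close> 55) where
  "(A \<^bold>\<equiv> B) = (A \<^bold>\<supset> B) \<^bold>\<and> (B \<^bold>\<supset> A)"

text \<open>Distinct atomic formulas are treated as distinct propositional atoms, so a
  valuation assigns a truth value to each pair of name variables independently.\<close>

primrec holds :: "(name \<Rightarrow> name \<Rightarrow> bool) \<Rightarrow> fm \<Rightarrow> bool" where
  "holds v (\<epsilon> x y) \<longleftrightarrow> v x y"
| "holds v (\<sim>A) \<longleftrightarrow> \<not> holds v A"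
| "holds v (A \<^bold>\<or> B) \<longleftrightarrow> holds v A \<or> holds v B"

definition tautology_instance :: "fm \<Rightarrow> bool" where
  "tautology_instance A \<longleftrightarrow> (\<forall>v. holds v A)"

primrec rename :: "(name \<Rightarrow> name) \<Rightarrow> fm \<Rightarrow> fm" where
  "rename \<sigma> (\<epsilon> x y) = \<epsilon> (\<sigma> x) (\<sigma> y)"
| "rename \<sigma> (\<sim>A) = \<sim>(rename \<sigma> A)"
| "rename \<sigma> (A \<^bold>\<or> B) = rename \<sigma> A \<^bold>\<or> rename \<sigma> B"

text \<open>The substitution sending, simultaneously, the \<open>i\<close>-th member of \<open>xs\<close>
  to the \<open>i\<close>-th member of \<open>ys\<close>, for \<open>xs\<close> distinct and of the same length as \<open>ys\<close>.\<close>

definition sending :: "name list \<Rightarrow> name list \<Rightarrow> name \<Rightarrow> name" where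
  "sending xs ys x = (case map_of (zip xs ys) x of None \<Rightarrow> x | Some y \<Rightarrow> y)"

section \<open>The system and its characteristic schemata\<close>

inductive_set mp_closure :: "fm set \<Rightarrow> fm set" for S where
  base: "A \<in> S \<Longrightarrow> A \<in> mp_closure S"
| mp: "A \<^bold>\<supset> B \<in> mp_closure S \<Longrightarrow> A \<in> mp_closure S \<Longrightarrow> B \<in> mp_closure S"

definition instances :: "fm \<Rightarrow> fm set" where
  "instances A = {rename \<sigma> A | \<sigma>. True}"

definition Ax1 :: fm where
  "Ax1 = \<epsilon> va vb \<^bold>\<supset> \<epsilon> va va"

definition Ax2 :: fm where
  "Ax2 = (\<epsilon> va vb \<^bold>\<and> \<epsilon> vb vc) \<^bold>\<supset> \<epsilon> va vc"

definition Ax3 :: fm where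
  "Ax3 = (\<epsilon> va vb \<^bold>\<and> \<epsilon> vb vc) \<^bold>\<supset> \<epsilon> vb va"

definition L1 :: "fm set" where
  "L1 = mp_closure ({A. tautology_instance A} \<union> instances Ax1 \<union> instances Ax2 \<union> instances Ax3)"

definition characteristic :: "fm \<Rightarrow> bool" where
  "characteristic A \<longleftrightarrow> mp_closure ({B. tautology_instance B} \<union> instances A) = L1"

section \<open>Triviality and quasi-triviality\<close>

primrec occurrences :: "fm \<Rightarrow> name list" where
  "occurrences (\<epsilon> x y) = [x, y]"
| "occurrences (\<sim>A) = occurrences A"
| "occurrences (A \<^bold>\<or> B) = occurrences A @ occurrences B"

text \<open>The function \<open>remdups\<close> keeps last occurrences; the two reversals
  turn this into keeping first occurrences.\<close>

definition nv :: "fm \<Rightarrow> name list" where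
  "nv A = rev (remdups (rev (occurrences A)))"

definition A_t :: fm where
  "A_t = \<epsilon> va vb \<^bold>\<supset> (\<epsilon> va va \<^bold>\<and> (\<epsilon> vb vc \<^bold>\<supset> (\<epsilon> va vc \<^bold>\<and> \<epsilon> vb va)))"

text \<open>Permutations act on indices counted from \<open>0\<close>:
  \<open>permute_list \<rho> xs\<close> is the list of the \<open>xs ! \<rho> i\<close>.\<close>

definition trivial :: "fm \<Rightarrow> bool" where
  "trivial A \<longleftrightarrow>
     3 \<le> length (nv A) \<and>
     (\<exists>\<rho> ys. \<rho> permutes {..<length (nv A)} \<and>
        length ys = length (nv A) - 3 \<and> distinct ys \<and>
        set ys \<inter> (set (nv A) \<union> {va, vb, vc}) = {} \<and>
        tautology_instance
          (rename (sending (permute_list \<rho> (nv A)) ([va, vb, vc] @ ys)) A \<^bold>\<equiv> A_t))"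

definition nontrivial :: "fm \<Rightarrow> bool" where
  "nontrivial A \<longleftrightarrow> \<not> trivial A"

definition quasi_trivial :: "fm \<Rightarrow> fm \<Rightarrow> bool" where
  "quasi_trivial A B \<longleftrightarrow>
     (let xs = nv A; ys = nv B; n = length xs; m = length ys in
        3 \<le> n \<and> 3 \<le> m \<and>
        (if n \<le> m then
           \<exists>\<rho> us. \<rho> permutes {..<m} \<and>
             length us = m - n \<and> distinct us \<and> set us \<inter> (set xs \<union> set ys) = {} \<and>
             tautology_instance (rename (sending (permute_list \<rho> ys) (xs @ us)) B \<^bold>\<equiv> A)
         else
           \<exists>\<rho> vs. \<rho> permutes {..<n} \<and>
             length vs = n - m \<and> distinct vs \<and> set vs \<inter> (set xs \<union> set ys) = {} \<and>
             tautology_instance (rename (sending (permute_list \<rho> xs) (ys @ vs)) A \<^bold>\<equiv> B)))"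

definition quasi_nontrivial :: "fm \<Rightarrow> fm \<Rightarrow> bool" where
  "quasi_nontrivial A B \<longleftrightarrow> \<not> quasi_trivial A B"

section \<open>The five schemata\<close>

definition A_M8 :: fm where
  "A_M8 = (\<epsilon> va vb \<^bold>\<and> \<epsilon> vc vd) \<^bold>\<supset>
     (\<epsilon> va va \<^bold>\<and> \<epsilon> vc vc \<^bold>\<and> (\<epsilon> vb vc \<^bold>\<supset> (\<epsilon> va vd \<^bold>\<and> \<epsilon> vb va)))"

definition A_S1 :: fm where
  "A_S1 = (\<epsilon> va vb \<^bold>\<and> \<epsilon> vc vd) \<^bold>\<supset>
     (\<epsilon> va va \<^bold>\<and> (\<epsilon> vb vc \<^bold>\<supset> (\<epsilon> va vd \<^bold>\<and> \<epsilon> vb va)))"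

definition A_S2 :: fm where
  "A_S2 = (\<epsilon> va vb \<^bold>\<and> \<epsilon> vc vd) \<^bold>\<supset>
     (\<epsilon> vc vc \<^bold>\<and> (\<epsilon> vb vc \<^bold>\<supset> (\<epsilon> va vd \<^bold>\<and> \<epsilon> vb va)))"

definition A_S3N :: fm where
  "A_S3N = \<epsilon> va vb \<^bold>\<supset>
     (\<epsilon> va va \<^bold>\<and> (\<epsilon> vb vc \<^bold>\<supset> (\<epsilon> vb vb \<^bold>\<and> (\<epsilon> vc vd \<^bold>\<supset> (\<epsilon> va vd \<^bold>\<and> \<epsilon> vb va)))))"

definition A_S3Nd :: fm where
  "A_S3Nd = \<epsilon> va vb \<^bold>\<supset>
     (\<epsilon> va va \<^bold>\<and> ((\<epsilon> vb vc \<^bold>\<and> \<epsilon> vc vd) \<^bold>\<supset> (\<epsilon> va vd \<^bold>\<and> \<epsilon> vb va)))"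

text \<open>The requirement of at least three name variables in the notions above
  is met by all five schemata, so their negations do not hold for lack of variables:\<close>

lemma nv_schemata:
  "nv A_M8 = [va, vb, vc, vd]" "nv A_S1 = [va, vb, vc, vd]" "nv A_S2 = [va, vb, vc, vd]"
  "nv A_S3N = [va, vb, vc, vd]" "nv A_S3Nd = [va, vb, vc, vd]"
  by (simp_all add: nv_def A_M8_def A_S1_def A_S2_def A_S3N_def A_S3Nd_def Con_def Imp_def)

end

theory Submission
  imports Defs
begin

text \<open>Each schema is interderivable with the axioms through a few explicit instances.
  For the negative claims, call an atom essential for a formula if the truth value of the
  formula can depend on it. An injective renaming carries essential atoms to essential atoms.
  The essential atoms of each of the five schemata involve four names, those of \<open>A_t\<close>
  only three, hence nontriviality. Apart from atoms of the form \<open>\<epsilon> x x\<close>, the five schemata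
  have the same essential atoms; these form a digraph on \<open>a, b, c, d\<close>
  without nonidentical injective endomorphisms, so quasi-triviality reduces to plain propositional
  equivalence, which explicit valuations refute.\<close>

section \<open>Derivability\<close>

lemma holds_connectives [simp]:
  "holds v (A \<^bold>\<and> B) \<longleftrightarrow> holds v A \<and> holds v B"
  "holds v (A \<^bold>\<supset> B) \<longleftrightarrow> (holds v A \<longrightarrow> holds v B)"
  "holds v (A \<^bold>\<equiv> B) \<longleftrightarrow> (holds v A \<longleftrightarrow> holds v B)"
  by (auto simp: Con_def Imp_def Equ_def)

lemma rename_connectives [simp]:
  "rename \<sigma> (A \<^bold>\<and> B) = rename \<sigma> A \<^bold>\<and> rename \<sigma> B"
  "rename \<sigma> (A \<^bold>\<supset> B) = rename \<sigma> A \<^bold>\<supset> rename \<sigma> B"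
  by (simp_all add: Con_def Imp_def)

lemma holds_rename: "holds v (rename \<sigma> A) \<longleftrightarrow> holds (\<lambda>x y. v (\<sigma> x) (\<sigma> y)) A"
  by (induction A) auto

lemma rename_rename: "rename \<sigma> (rename \<tau> A) = rename (\<sigma> \<circ> \<tau>) A"
  by (induction A) auto

lemma rename_in_instances: "B \<in> instances A \<Longrightarrow> rename \<sigma> B \<in> instances A"
  by (auto simp: instances_def rename_rename)

lemma tautology_instance_rename: "tautology_instance A \<Longrightarrow> tautology_instance (rename \<sigma> A)"
  by (simp add: tautology_instance_def holds_rename)

lemma mp_closure_minimal:
  assumes "S \<subseteq> mp_closure T"
  shows "mp_closure S \<subseteq> mp_closure T"
proof
  fix A
  assume "A \<in> mp_closure S"
  then show "A \<in> mp_closure T"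
    by induction (use assms in \<open>auto intro: mp_closure.mp\<close>)
qed

text \<open>Renaming is not a rule of the closure; it is admissible because it commutes with
  implication and preserves the generating set.\<close>

lemma mp_closure_rename:
  assumes "A \<in> mp_closure S" and "\<And>B. B \<in> S \<Longrightarrow> rename \<sigma> B \<in> S"
  shows "rename \<sigma> A \<in> mp_closure S"
  using assms(1)
  by induction (use assms(2) in \<open>auto intro: mp_closure.intros\<close>)

text \<open>The premises are moved one at a time into the conclusion, ending in a tautology, and
  modus ponens discharges them again. Later derivations thereby become propositional checks over a
  finite list of instances.\<close>

lemma mp_closure_consequence:
  assumes "{A. tautology_instance A} \<subseteq> S" and "set Bs \<subseteq> mp_closure S"
    and "\<And>v. (\<forall>B \<in> set Bs. holds v B) \<Longrightarrow> holds v C"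
  shows "C \<in> mp_closure S"
  using assms(2,3)
proof (induction Bs arbitrary: C)
  case Nil
  then show ?case
    using assms(1) by (auto simp: tautology_instance_def intro: mp_closure.base)
next
  case (Cons B Bs)
  have "B \<^bold>\<supset> C \<in> mp_closure S"
    using Cons.prems by (intro Cons.IH) auto
  then show ?case
    using Cons.prems(1) by (auto intro: mp_closure.mp)
qed

lemma Ax_rename_in_L1:
  "rename \<sigma> Ax1 \<in> L1" "rename \<sigma> Ax2 \<in> L1" "rename \<sigma> Ax3 \<in> L1"
  by (auto simp: L1_def instances_def intro: mp_closure.base)

lemma L1_rename: "A \<in> L1 \<Longrightarrow> rename \<sigma> A \<in> L1"
  unfolding L1_def
  by (rule mp_closure_rename) (auto simp: tautology_instance_rename rename_in_instances)

text \<open>The conditions on \<open>v\<close> say that six axiom instances hold: \<open>Ax1\<close>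
  at ab, bc, cd, \<open>Ax2\<close> at abc, acd, and \<open>Ax3\<close> at abc. These suffice for
  all five schemata.\<close>

lemma in_L1I:
  assumes "\<And>v. \<lbrakk>v va vb \<Longrightarrow> v va va; v vb vc \<Longrightarrow> v vb vb; v vc vd \<Longrightarrow> v vc vc;
      v va vb \<Longrightarrow> v vb vc \<Longrightarrow> v va vc; v va vc \<Longrightarrow> v vc vd \<Longrightarrow> v va vd;
      v va vb \<Longrightarrow> v vb vc \<Longrightarrow> v vb va\<rbrakk> \<Longrightarrow> holds v A"
  shows "A \<in> L1"
proof -
  let ?Bs = "[rename id Ax1, rename (id(va := vb, vb := vc)) Ax1, rename (id(va := vc, vb := vd)) Ax1,
    rename id Ax2, rename (id(vb := vc, vc := vd)) Ax2, rename id Ax3]"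
  have "set ?Bs \<subseteq> L1"
    by (simp add: Ax_rename_in_L1)
  moreover have "holds v A" if "\<forall>B \<in> set ?Bs. holds v B" for v
    using that by (intro assms) (simp_all add: Ax1_def Ax2_def Ax3_def)
  ultimately show ?thesis
    unfolding L1_def by (intro mp_closure_consequence[of _ ?Bs]) auto
qed

text \<open>Two instances recover the axioms. Sending c, d to a, b yields \<open>Ax1\<close>, even
  for \<open>A_S2\<close>, whose conjunct cc becomes aa. Sending c, d to b, c turns the condition bc
  into bb, which \<open>Ax1\<close> supplies from bc, and so releases the conclusions of
  \<open>Ax2\<close> and \<open>Ax3\<close>.\<close>

lemma characteristicI:
  assumes X: "X \<in> L1"
    and Ax1: "\<And>v. holds v (rename (id(vc := va, vd := vb)) X) \<Longrightarrow> holds v Ax1"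
    and Ax23: "\<And>v. \<lbrakk>holds v (rename (id(vc := vb, vd := vc)) X); v vb vc \<Longrightarrow> v vb vb\<rbrakk>
      \<Longrightarrow> holds v Ax2 \<and> holds v Ax3"
  shows "characteristic X"
proof -
  define S where "S = {B. tautology_instance B} \<union> instances X"
  have taut: "{A. tautology_instance A} \<subseteq> S"
    by (simp add: S_def)
  have rename: "rename \<sigma> A \<in> mp_closure S" if "A \<in> mp_closure S" for \<sigma> A
    using that by (rule mp_closure_rename)
      (auto simp: S_def tautology_instance_rename rename_in_instances)
  have inst: "rename \<sigma> X \<in> mp_closure S" for \<sigma>
    by (auto simp: S_def instances_def intro: mp_closure.base)
  have 1: "Ax1 \<in> mp_closure S"
    using taut Ax1 inst
    by (intro mp_closure_consequence[of S "[rename (id(vc := va, vd := vb)) X]"]) auto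
  have "Ax2 \<^bold>\<and> Ax3 \<in> mp_closure S"
  proof (rule mp_closure_consequence)
    let ?Bs = "[rename (id(vc := vb, vd := vc)) X, rename (id(va := vb, vb := vc)) Ax1]"
    show "set ?Bs \<subseteq> mp_closure S"
      using inst rename[OF 1] by simp
    show "holds v (Ax2 \<^bold>\<and> Ax3)" if "\<forall>B \<in> set ?Bs. holds v B" for v
      using that Ax23[of v] by (auto simp: Ax1_def)
  qed (fact taut)
  then have 2: "Ax2 \<in> mp_closure S" and 3: "Ax3 \<in> mp_closure S"
    by (auto intro: mp_closure_consequence[OF taut, of "[Ax2 \<^bold>\<and> Ax3]"])
  have "L1 \<subseteq> mp_closure S"
    unfolding L1_def
    by (rule mp_closure_minimal)
      (use 1 2 3 taut rename in \<open>auto simp: instances_def intro: mp_closure.base\<close>)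
  moreover have "mp_closure S \<subseteq> L1"
    unfolding L1_def
    by (rule mp_closure_minimal)
      (use L1_rename[OF X] in \<open>auto simp: S_def instances_def L1_def intro: mp_closure.base\<close>)
  ultimately show ?thesis
    unfolding characteristic_def S_def by blast
qed

definition schemata :: "fm set" where
  "schemata = {A_M8, A_S1, A_S2, A_S3N, A_S3Nd}"

lemmas schemata_defs = A_M8_def A_S1_def A_S2_def A_S3N_def A_S3Nd_def

lemma characteristic_schemata:
  assumes "X \<in> schemata"
  shows "characteristic X"
proof (rule characteristicI)
  show "X \<in> L1"
    by (rule in_L1I) (use assms in \<open>auto simp: schemata_def schemata_defs\<close>)
qed (use assms in \<open>auto simp: schemata_def schemata_defs Ax1_def Ax2_def Ax3_def\<close>)

section \<open>Essential atoms\<close>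

primrec atoms :: "fm \<Rightarrow> (name \<times> name) set" where
  "atoms (\<epsilon> x y) = {(x, y)}"
| "atoms (\<sim>A) = atoms A"
| "atoms (A \<^bold>\<or> B) = atoms A \<union> atoms B"

lemma atoms_connectives [simp]:
  "atoms (A \<^bold>\<and> B) = atoms A \<union> atoms B"
  "atoms (A \<^bold>\<supset> B) = atoms A \<union> atoms B"
  by (simp_all add: Con_def Imp_def)

lemma holds_cong_atoms:
  "(\<And>x y. (x, y) \<in> atoms A \<Longrightarrow> v x y = w x y) \<Longrightarrow> holds v A = holds w A"
  by (induction A) auto

text \<open>Unlike \<open>atoms\<close>, this set is invariant under propositional equivalence, so
  it can be transported along the equivalences in the two triviality notions.\<close>

definition essential :: "fm \<Rightarrow> (name \<times> name) set" where
  "essential A = {(x, y). \<exists>v w. holds v A \<noteq> holds w A \<and>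
     (\<forall>p q. (p, q) \<noteq> (x, y) \<longrightarrow> v p q = w p q)}"

lemma essential_subset_atoms: "essential A \<subseteq> atoms A"
proof clarify
  fix x y
  assume "(x, y) \<in> essential A"
  then obtain v w where "holds v A \<noteq> holds w A" "\<And>p q. (p, q) \<noteq> (x, y) \<Longrightarrow> v p q = w p q"
    unfolding essential_def by blast
  then show "(x, y) \<in> atoms A"
    using holds_cong_atoms[of A v w] by metis
qed

lemma essential_cong:
  assumes "tautology_instance (A \<^bold>\<equiv> B)"
  shows "essential A = essential B"
  using assms by (simp add: tautology_instance_def essential_def)

lemma essential_rename:
  assumes inj: "inj_on f N" and N: "atoms A \<subseteq> N \<times> N" and xy: "(x, y) \<in> essential A"
  shows "(f x, f y) \<in> essential (rename f A)"
proof -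
  obtain v w where vw: "holds v A \<noteq> holds w A" "\<And>p q. (p, q) \<noteq> (x, y) \<Longrightarrow> v p q = w p q"
    using xy unfolding essential_def by blast
  have xyN: "x \<in> N" "y \<in> N"
    using xy essential_subset_atoms N by auto
  define g where "g = inv_into N f"
  have g: "g (f p) = p" if "p \<in> N" for p
    using inj that by (simp add: g_def)
  \<comment> \<open>\<open>lift u\<close> carries \<open>u\<close> along \<open>f\<close>. The fixed
    value off the image makes the lifts of \<open>v\<close> and \<open>w\<close> agree there, so
    they can differ only at \<open>(f x, f y)\<close>.\<close>
  define lift where "lift u p q = (if p \<in> f ` N \<and> q \<in> f ` N then u (g p) (g q) else False)"
    for u :: "name \<Rightarrow> name \<Rightarrow> bool" and p q
  have "lift u (f p) (f q) = u p q" if "(p, q) \<in> atoms A" for u p q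
  proof -
    have "p \<in> N" "q \<in> N"
      using that N by auto
    then show ?thesis
      by (simp add: lift_def g)
  qed
  then have lift: "holds (lift u) (rename f A) \<longleftrightarrow> holds u A" for u
    unfolding holds_rename by (rule holds_cong_atoms)
  have "lift v p q = lift w p q" if "(p, q) \<noteq> (f x, f y)" for p q
    using that by (auto simp: lift_def g intro!: vw(2))
  then show ?thesis
    using vw(1) lift unfolding essential_def by blast
qed

section \<open>Substitutions as bijections between sets of names\<close>

lemma bij_betw_sending:
  assumes "distinct xs" "distinct ys" "length xs = length ys"
  shows "bij_betw (sending xs ys) (set xs) (set ys)"
proof (rule bij_betw_imageI)
  have nth: "sending xs ys (xs ! i) = ys ! i" if "i < length xs" for i
    using assms that by (simp add: sending_def map_of_zip_nth)
  show "inj_on (sending xs ys) (set xs)"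
    using assms by (auto simp: inj_on_def in_set_conv_nth nth nth_eq_iff_index_eq)
  have "map (sending xs ys) xs = ys"
    using assms by (intro nth_equalityI) (auto simp: nth)
  then show "sending xs ys ` set xs = set ys"
    by (metis list.set_map)
qed

lemma bij_betw_sending_permute_list:
  assumes "\<rho> permutes {..<length xs}" "distinct xs" "distinct ys" "length xs = length ys"
  shows "bij_betw (sending (permute_list \<rho> xs) ys) (set xs) (set ys)"
  using bij_betw_sending[of "permute_list \<rho> xs" ys] assms by simp

section \<open>The five schemata\<close>

definition common_atoms :: "(name \<times> name) set" where
  "common_atoms = {(va, vb), (vb, va), (vb, vc), (vc, vd), (va, vd)}"

lemma common_atoms_essential:
  assumes "X \<in> schemata"
  shows "common_atoms \<subseteq> essential X"
proof -
  have ess: "(x, y) \<in> essential X"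
    if "holds (\<lambda>p q. (p, q) \<notin> S) X \<noteq> holds (\<lambda>p q. (p, q) \<notin> insert (x, y) S) X" for S x y
    using that unfolding essential_def
    by (intro CollectI case_prodI exI conjI) auto
  \<comment> \<open>With only ad and ba false, the schema fails; making one of its conditions ab,
    bc, cd false as well restores it.\<close>
  have "(x, y) \<in> essential X" if "(x, y) \<in> {(va, vb), (vb, vc), (vc, vd)}" for x y
    using assms that by (intro ess[of "{(va, vd), (vb, va)}"])
      (auto simp: schemata_def schemata_defs)
  \<comment> \<open>When every atom is true the schema holds, and it fails once ad or ba is made
    false.\<close>
  moreover have "(x, y) \<in> essential X" if "(x, y) \<in> {(va, vd), (vb, va)}" for x y
    using assms that by (intro ess[of "{}"]) (auto simp: schemata_def schemata_defs)
  ultimately show ?thesis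
    by (auto simp: common_atoms_def)
qed

lemma atoms_schemata:
  assumes "X \<in> schemata"
  shows "atoms X \<subseteq> common_atoms \<union> Id" "atoms X \<subseteq> {va, vb, vc, vd} \<times> {va, vb, vc, vd}"
  using assms unfolding schemata_def
  by (elim insertE emptyE; simp add: schemata_defs common_atoms_def)+

lemma nv_of_schemata: "X \<in> schemata \<Longrightarrow> nv X = [va, vb, vc, vd]"
  by (auto simp: schemata_def nv_schemata)

section \<open>Nontriviality\<close>

lemma nontrivial_schemata:
  assumes X: "X \<in> schemata"
  shows "nontrivial X"
  unfolding nontrivial_def
proof
  assume "trivial X"
  then obtain \<rho> ys where \<rho>: "\<rho> permutes {..<length [va, vb, vc, vd]}"
    and ys: "length ys = 1" "distinct ys" "set ys \<inter> {va, vb, vc, vd} = {}"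
    and taut: "tautology_instance
      (rename (sending (permute_list \<rho> [va, vb, vc, vd]) ([va, vb, vc] @ ys)) X \<^bold>\<equiv> A_t)"
    unfolding trivial_def nv_of_schemata[OF X] by auto
  define f where "f = sending (permute_list \<rho> [va, vb, vc, vd]) ([va, vb, vc] @ ys)"
  have "bij_betw f (set [va, vb, vc, vd]) (set ([va, vb, vc] @ ys))"
    unfolding f_def by (rule bij_betw_sending_permute_list[OF \<rho>]) (use ys in auto)
  then have inj: "inj_on f {va, vb, vc, vd}"
    by (simp add: bij_betw_def)
  have "(f x, f y) \<in> atoms A_t" if "(x, y) \<in> common_atoms" for x y
    using that essential_rename[OF inj atoms_schemata(2)[OF X]] common_atoms_essential[OF X]
      essential_cong[OF taut[folded f_def]] essential_subset_atoms[of A_t] by blast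
  moreover have "atoms A_t \<subseteq> {va, vb, vc} \<times> {va, vb, vc}"
    by (auto simp: A_t_def)
  ultimately have "f x \<in> {va, vb, vc} \<and> f y \<in> {va, vb, vc}" if "(x, y) \<in> common_atoms" for x y
    using that by blast
  \<comment> \<open>The edges ab and cd meet all four names, so the injective \<open>f\<close> would
    map four names into three.\<close>
  from this[of va vb] this[of vc vd] have "f ` {va, vb, vc, vd} \<subseteq> {va, vb, vc}"
    by (simp add: common_atoms_def)
  from card_inj_on_le[OF inj this] show False
    by simp
qed

section \<open>Rigidity and quasi-nontriviality\<close>

lemma common_atoms_rigid:
  assumes "inj_on f {va, vb, vc, vd}"
    and "\<And>x y. (x, y) \<in> common_atoms \<Longrightarrow> (f x, f y) \<in> common_atoms"
    and "x \<in> {va, vb, vc, vd}"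
  shows "f x = x"
proof -
  have dist: "f va \<noteq> f vc" "f va \<noteq> f vd" "f vb \<noteq> f vc" "f vb \<noteq> f vd"
    using assms(1) by (auto simp: inj_on_def)
  have edge: "(f va, f vb) \<in> common_atoms" "(f vb, f va) \<in> common_atoms"
    "(f vb, f vc) \<in> common_atoms" "(f vc, f vd) \<in> common_atoms" "(f va, f vd) \<in> common_atoms"
    by (intro assms(2); simp add: common_atoms_def)+
  \<comment> \<open>The edges ab and ba form the only 2-cycle, so \<open>f\<close> fixes or swaps a
    and b.\<close>
  have "f va = va \<and> f vb = vb \<or> f va = vb \<and> f vb = va"
    using edge(1,2) unfolding common_atoms_def by simp linarith
  \<comment> \<open>A swap would send c to d by the edge bc, but no edge leaves d to receive the
    image of cd. Otherwise bc forces c to be fixed, and then cd fixes d.\<close>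
  then have "f va = va \<and> f vb = vb \<and> f vc = vc \<and> f vd = vd"
    using edge(3-5) dist unfolding common_atoms_def by (elim disjE conjE) simp_all
  then show ?thesis
    using assms(3) by auto
qed

lemma quasi_trivial_schemata_imp_equivalent:
  assumes X: "X \<in> schemata" and Y: "Y \<in> schemata" and "quasi_trivial X Y"
  shows "holds v X \<longleftrightarrow> holds v Y"
proof -
  \<comment> \<open>Both tuples have length four, so the first case of the definition applies and
    \<open>us\<close> is empty.\<close>
  obtain \<rho> where \<rho>: "\<rho> permutes {..<length [va, vb, vc, vd]}"
    and taut: "tautology_instance
      (rename (sending (permute_list \<rho> [va, vb, vc, vd]) [va, vb, vc, vd]) Y \<^bold>\<equiv> X)"
    using assms(3) unfolding quasi_trivial_def Let_def nv_of_schemata[OF X] nv_of_schemata[OF Y]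
    by auto
  define f where "f = sending (permute_list \<rho> [va, vb, vc, vd]) [va, vb, vc, vd]"
  have "bij_betw f (set [va, vb, vc, vd]) (set [va, vb, vc, vd])"
    unfolding f_def by (rule bij_betw_sending_permute_list[OF \<rho>]) auto
  then have inj: "inj_on f {va, vb, vc, vd}"
    by (simp add: bij_betw_def)
  have "(f x, f y) \<in> common_atoms" if xy: "(x, y) \<in> common_atoms" for x y
  proof -
    have "(f x, f y) \<in> atoms X"
      using xy essential_rename[OF inj atoms_schemata(2)[OF Y]] common_atoms_essential[OF Y]
        essential_cong[OF taut[folded f_def]] essential_subset_atoms[of X] by blast
    \<comment> \<open>Diagonal atoms of \<open>X\<close> may be essential too; injectivity rules
      them out as images of common atoms.\<close>
    moreover have "f x \<noteq> f y"
      using xy inj by (auto simp: common_atoms_def inj_on_def)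
    ultimately show ?thesis
      using atoms_schemata(1)[OF X] by auto
  qed
  note f_id = common_atoms_rigid[OF inj this]
  have "holds v (rename f Y) \<longleftrightarrow> holds v Y"
    unfolding holds_rename
  proof (rule holds_cong_atoms)
    fix x y
    assume "(x, y) \<in> atoms Y"
    then have "x \<in> {va, vb, vc, vd}" "y \<in> {va, vb, vc, vd}"
      using atoms_schemata(2)[OF Y] by blast+
    then show "v (f x) (f y) = v x y"
      by (simp only: f_id)
  qed
  then show ?thesis
    using taut by (simp add: tautology_instance_def f_def)
qed

text \<open>The first three valuations, each with one false diagonal atom, separate all pairs except
  \<open>A_S1\<close> and \<open>A_S3Nd\<close>. The last one separates these: with aa and cd false,
  \<open>A_S1\<close> holds since cd is among its outer conditions, while \<open>A_S3Nd\<close>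
  demands aa from ab alone.\<close>

lemma schemata_separated:
  assumes "X \<in> schemata" "Y \<in> schemata" "X \<noteq> Y"
  shows "\<exists>S \<in> {{(va, va)}, {(vb, vb)}, {(vc, vc)}, {(va, va), (vc, vd)}}.
    holds (\<lambda>p q. (p, q) \<notin> S) X \<noteq> holds (\<lambda>p q. (p, q) \<notin> S) Y"
  using assms unfolding schemata_def
  by (elim insertE emptyE) (simp_all add: schemata_defs)

lemma quasi_nontrivial_schemata:
  assumes "X \<in> schemata" "Y \<in> schemata" "X \<noteq> Y"
  shows "quasi_nontrivial X Y"
  using schemata_separated[OF assms] quasi_trivial_schemata_imp_equivalent[OF assms(1,2)]
  unfolding quasi_nontrivial_def by blast

lemma schemata_distinct: "distinct [A_M8, A_S1, A_S2, A_S3N, A_S3Nd]"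
  by (simp add: schemata_defs Con_def Imp_def)

theorem theorem8p1:
  shows "(\<forall>X \<in> {A_M8, A_S1, A_S2, A_S3N, A_S3Nd}. characteristic X \<and> nontrivial X)
    \<and> (\<forall>Y \<in> {A_S1, A_S2, A_S3N, A_S3Nd}. quasi_nontrivial A_M8 Y)
    \<and> (\<forall>Y \<in> {A_M8, A_S2, A_S3N, A_S3Nd}. quasi_nontrivial A_S1 Y)
    \<and> (\<forall>Y \<in> {A_M8, A_S1, A_S3N, A_S3Nd}. quasi_nontrivial A_S2 Y)
    \<and> (\<forall>Y \<in> {A_M8, A_S1, A_S2, A_S3Nd}. quasi_nontrivial A_S3N Y)
    \<and> (\<forall>Y \<in> {A_M8, A_S1, A_S2, A_S3N}. quasi_nontrivial A_S3Nd Y)"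
proof -
  have "X \<in> schemata" if "X \<in> {A_M8, A_S1, A_S2, A_S3N, A_S3Nd}" for X
    using that by (simp add: schemata_def)
  moreover note schemata_distinct
  ultimately show ?thesis
    using characteristic_schemata nontrivial_schemata quasi_nontrivial_schemata
    by auto
qed

end
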